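(* Let $F\subset\mathrm{Sym}^2(\mathbb R^n)$ be a subequation, and let $\psi:(a,b)\to[-\infty,\infty)$ be upper semi-continuous, where $(a,b)\subset(0,\infty)$. The function $u(x)=\psi(|x|)$ is an increasing, radial $F$-subharmonic function on $\{x\in\mathbb R^n:a<|x|<b\}$ (that is, $u$ is $F$-subharmonic and $\psi$ is non-decreasing) if and only if $\psi(t)$ is $R_F^{\uparrow}$-subharmonic on $(a,b)$.
   Context: $\mathrm{Sym}^2(\mathbb R^n)$ is the space of real symmetric $n\times n$ matrices and $\mathcal P=\{A: A\ge 0\}$. A subequation is a closed subset $F\subset \mathrm{Sym}^2(\mathbb R^n)$ with $F+\mathcal P\subset F$ (here $F$ need not be a cone). For a unit vector $e\in\mathbb R^n$, $P_e$ and $P_{e^\perp}=I-P_e$ are the orthogonal projections onto the line $\mathbb Re$ and the hyperplane $e^\perp$. An upper semi-continuous $u:X\to[-\infty,\infty)$ on an open set $X\subset\mathbb R^n$ is $F$-subharmonic if whenever $x_0\in X$ and $\varphi$ is $C^2$ near $x_0$ with $u\le\varphi$ near $x_0$ and $u(x_0)=\varphi(x_0)$, one has $D^2\varphi(x_0)\in F$. The increasing radial subequation $R_F^\uparrow$ on $(0,\infty)$ has fibre at $t>0$ $$(R_F^\uparrow)_t=\Bigl\{(\lambda,a)\in\mathbb R^2:\ \lambda\ge0\ \text{ and }\ \tfrac{\lambda}{t}P_{e^\perp}+aP_e\in F\ \text{ for all unit vectors } e\Bigr\}.$$ An upper semi-continuous $\psi:(a,b)\to[-\infty,\infty)$ is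 $R_F^\uparrow$-subharmonic if whenever $t_0\in(a,b)$ and $\varphi$ is $C^2$ near $t_0$ with $\psi\le\varphi$ near $t_0$ and $\psi(t_0)=\varphi(t_0)$, one has $(\varphi'(t_0),\varphi''(t_0))\in(R_F^\uparrow)_{t_0}$. *)

theory Defs
  imports "HOL-Analysis.Analysis"
begin

section \<open>Subequations\<close>

definition sym_matrices :: "(real^'n^'n) set" where
  "sym_matrices = {A. transpose A = A}"

definition psd_matrices :: "(real^'n^'n) set" where
  "psd_matrices = {A \<in> sym_matrices. \<forall>v. 0 \<le> v \<bullet> (A *v v)}"

definition subequation :: "(real^'n^'n) set \<Rightarrow> bool" where
  "subequation F \<longleftrightarrow>
     closedin (top_of_set sym_matrices) F \<and> (\<forall>A\<in>F. \<forall>P\<in>psd_matrices. A + P \<in> F)"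


section \<open>Functions with values in \<open>[-\<infinity>, \<infinity>)\<close> and test functions\<close>

text \<open>A function \<open>X \<rightarrow> [-\<infinity>, \<infinity>)\<close> is a total \<open>ereal\<close>-valued function of which only the values
  on \<open>X\<close> matter.\<close>

definition usc_on :: "'a::topological_space set \<Rightarrow> ('a \<Rightarrow> ereal) \<Rightarrow> bool" where
  "usc_on X u \<longleftrightarrow>
     (\<forall>x\<in>X. u x \<noteq> \<infinity>) \<and> (\<forall>c. openin (top_of_set X) {x \<in> X. u x < c})"

definition touches_above :: "('a::topological_space \<Rightarrow> real) \<Rightarrow> ('a \<Rightarrow> ereal) \<Rightarrow> 'a \<Rightarrow> bool" where
  "touches_above \<phi> u x0 \<longleftrightarrow>
     (\<forall>\<^sub>F x in nhds x0. u x \<le> ereal (\<phi> x)) \<and> u x0 = ereal (\<phi> x0)"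

definition gradient :: "(real^'n \<Rightarrow> real) \<Rightarrow> real^'n \<Rightarrow> real^'n" where
  "gradient f x = (\<chi> i. frechet_derivative f (at x) (axis i 1))"

definition hessian :: "(real^'n \<Rightarrow> real) \<Rightarrow> real^'n \<Rightarrow> real^'n^'n" where
  "hessian f x = jacobian (gradient f) (at x)"

definition C2_near :: "(real^'n \<Rightarrow> real) \<Rightarrow> real^'n \<Rightarrow> bool" where
  "C2_near f x0 \<longleftrightarrow>
     (\<exists>U. open U \<and> x0 \<in> U \<and> f differentiable_on U \<and> gradient f differentiable_on U \<and>
          continuous_on U (hessian f))"

definition C2_near_real :: "(real \<Rightarrow> real) \<Rightarrow> real \<Rightarrow> bool" where
  "C2_near_real f t0 \<longleftrightarrow>
     (\<exists>U. open U \<and> t0 \<in> U \<and> f differentiable_on U \<and> deriv f differentiable_on U \<and>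
          continuous_on U (deriv (deriv f)))"


section \<open>Subharmonicity\<close>

definition subharmonic_on :: "(real^'n^'n) set \<Rightarrow> (real^'n) set \<Rightarrow> (real^'n \<Rightarrow> ereal) \<Rightarrow> bool" where
  "subharmonic_on F X u \<longleftrightarrow> open X \<and> usc_on X u \<and>
     (\<forall>x0\<in>X. \<forall>\<phi>. C2_near \<phi> x0 \<and> touches_above \<phi> u x0 \<longrightarrow> hessian \<phi> x0 \<in> F)"

definition proj_line :: "real^'n \<Rightarrow> real^'n^'n" where
  "proj_line e = matrix (\<lambda>x. (x \<bullet> e) *\<^sub>R e)"

definition proj_perp :: "real^'n \<Rightarrow> real^'n^'n" where
  "proj_perp e = mat 1 - proj_line e"

definition incr_radial_subeq :: "(real^'n^'n) set \<Rightarrow> real \<Rightarrow> (real \<times> real) set" where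
  "incr_radial_subeq F t =
     {(l, a). 0 \<le> l \<and> (\<forall>e. norm e = 1 \<longrightarrow> (l / t) *\<^sub>R proj_perp e + a *\<^sub>R proj_line e \<in> F)}"

text \<open>\<open>R t\<close> is the fibre at \<open>t\<close> of a (variable coefficient, gradient dependent) subequation on an
  open set \<open>J\<close> of reals.\<close>

definition subharmonic_on_real ::
    "(real \<Rightarrow> (real \<times> real) set) \<Rightarrow> real set \<Rightarrow> (real \<Rightarrow> ereal) \<Rightarrow> bool" where
  "subharmonic_on_real R J \<psi> \<longleftrightarrow> open J \<and> usc_on J \<psi> \<and>
     (\<forall>t0\<in>J. \<forall>\<phi>. C2_near_real \<phi> t0 \<and> touches_above \<phi> \<psi> t0 \<longrightarrow>
        (deriv \<phi> t0, deriv (deriv \<phi>) t0) \<in> R t0)"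

end

theory Submission
  imports Defs
begin

text \<open>
  Every radius \<open>t\<close> and unit vector \<open>e\<close> tie the two notions together through the formula
  \<open>D\<^sup>2(\<phi>(|x|)) = (\<phi>'(t)/t) (I - P\<^sub>e) + \<phi>''(t) P\<^sub>e\<close> at \<open>x = t e\<close> (\<open>C2_near_radial\<close>).

  If \<open>u(x) = \<psi>(|x|)\<close> is \<open>F\<close>-subharmonic, a test function \<open>\<phi>\<close> for \<open>\<psi>\<close> at \<open>t\<close> gives the test function
  \<open>\<phi>(|x|)\<close> for \<open>u\<close> at each \<open>t e\<close>, and the formula is exactly the condition on the fibre. The sign
  condition \<open>\<phi>'(t) \<ge> 0\<close> is what monotonicity of \<open>\<psi>\<close> says about test functions.

  Conversely, let \<open>\<psi>\<close> be subharmonic for the radial subequation.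
  Any decrease of \<open>\<psi>\<close> would make it touched from above by a translate of a steep decreasing
  exponential (\<open>mono_on_if_no_decreasing_test\<close>), so \<open>\<psi>\<close> is non-decreasing.
  Now let \<open>\<phi>\<close> be a test function for \<open>u\<close> at \<open>x\<^sub>0 = \<rho> e\<close>, with Hessian \<open>H\<close> there and radial
  derivative \<open>\<lambda>\<close>; put \<open>\<mu> = \<lambda>/\<rho>\<close>.
  Restricting \<open>\<phi>\<close> to the ray through \<open>e\<close> only sees \<open>(\<lambda>, H e \<bullet> e)\<close>. That is not enough, because the
  mixed terms \<open>H e \<bullet> v\<close>, \<open>v \<bottom> e\<close>, need not vanish, so that \<open>H\<close> need not dominate
  \<open>\<mu> (I - P\<^sub>e) + (H e \<bullet> e) P\<^sub>e\<close>.
  The remedy is that \<open>u\<close> depends on \<open>|x|\<close> only, so \<open>\<phi>\<close> may be restricted to any curve \<open>\<gamma>\<close> with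
  \<open>|\<gamma>(t)| = t\<close> that passes through \<open>x\<^sub>0\<close>. If \<open>\<gamma>\<close> has velocity \<open>e + v\<close> at \<open>x\<^sub>0\<close>, the restriction is a test
  function for \<open>\<psi>\<close> with first derivative \<open>\<lambda>\<close> and second derivative
  \<open>a(v) = (e + v) \<bullet> H (e + v) - \<mu> |v|\<^sup>2\<close> (\<open>touches_above_along_polar_curve\<close>), whence
  \<open>\<mu> (I - P\<^sub>e) + a(v) P\<^sub>e \<in> F\<close> for every \<open>v \<bottom> e\<close>.
  Restricting \<open>\<phi>\<close> to the sphere \<open>|x| = \<rho>\<close>, where it has a local minimum at \<open>x\<^sub>0\<close>, shows that
  \<open>v \<bullet> H v \<ge> \<mu> |v|\<^sup>2\<close>, so \<open>a\<close> is a convex quadratic function of \<open>v\<close>. After replacing \<open>H\<close> by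
  \<open>H + \<epsilon> I\<close> it has a minimiser, which amounts to completing the square: for that \<open>v\<close> the matrix
  \<open>H + \<epsilon> I\<close> does dominate \<open>\<mu> (I - P\<^sub>e) + a(v) P\<^sub>e\<close> (\<open>radial_matrix_below_perturbation\<close>), hence lies in \<open>F\<close>.
  Letting \<open>\<epsilon> \<rightarrow> 0\<close> gives \<open>H \<in> F\<close>, as \<open>F\<close> is closed.
\<close>

section \<open>Gradients, Hessians and second derivatives\<close>

lemma gradient_eqI:
  fixes f :: "real^'n \<Rightarrow> real"
  assumes "(f has_derivative (\<lambda>h. g \<bullet> h)) (at x)"
  shows "gradient f x = g"
  using frechet_derivative_at[OF assms, symmetric]
  by (simp add: gradient_def vec_eq_iff inner_axis)

text \<open>The derivative of a real-valued function is a linear functional, hence the inner product with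
  the image of \<open>1\<close> under its adjoint; by uniqueness that vector is the gradient.\<close>

lemma has_derivative_gradient:
  fixes f :: "real^'n \<Rightarrow> real"
  assumes "f differentiable at x"
  shows "(f has_derivative (\<lambda>h. gradient f x \<bullet> h)) (at x)"
proof -
  obtain D where D: "(f has_derivative D) (at x)"
    using assms differentiable_def by blast
  then have lin: "linear D"
    by (rule has_derivative_linear)
  have "D = (\<lambda>h. adjoint D 1 \<bullet> h)"
    using adjoint_works[OF lin, of _ 1] by (simp add: fun_eq_iff inner_commute)
  then show ?thesis
    using D gradient_eqI by metis
qed

lemma C2_nearE:
  fixes f :: "real^'n \<Rightarrow> real"
  assumes "C2_near f x0"
  obtains U where "open U" "x0 \<in> U"
    "\<And>x. x \<in> U \<Longrightarrow> (f has_derivative (\<lambda>h. gradient f x \<bullet> h)) (at x)"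
    "\<And>x. x \<in> U \<Longrightarrow> (gradient f has_derivative (\<lambda>h. hessian f x *v h)) (at x)"
    "continuous_on U (hessian f)"
proof -
  obtain U where U: "open U" "x0 \<in> U" "f differentiable_on U" "gradient f differentiable_on U"
      "continuous_on U (hessian f)"
    using assms unfolding C2_near_def by blast
  show thesis
  proof
    fix x assume "x \<in> U"
    then have "f differentiable at x" "gradient f differentiable at x"
      using U differentiable_on_eq_differentiable_at by blast+
    then show "(f has_derivative (\<lambda>h. gradient f x \<bullet> h)) (at x)"
        "(gradient f has_derivative (\<lambda>h. hessian f x *v h)) (at x)"
      using has_derivative_gradient jacobian_works unfolding hessian_def by blast+
  qed (use U in auto)
qed

lemma C2_nearI:
  fixes f :: "real^'n \<Rightarrow> real"
  assumes U: "open U" "x0 \<in> U"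
    and D1: "\<And>x. x \<in> U \<Longrightarrow> (f has_derivative (\<lambda>h. G x \<bullet> h)) (at x)"
    and D2: "\<And>x. x \<in> U \<Longrightarrow> (G has_derivative (\<lambda>h. H x *v h)) (at x)"
    and cont: "continuous_on U H"
  shows "C2_near f x0" "hessian f x0 = H x0"
proof -
  have grad: "gradient f x = G x" if "x \<in> U" for x
    using gradient_eqI D1 that by blast
  have D2': "(gradient f has_derivative (\<lambda>h. H x *v h)) (at x)" if "x \<in> U" for x
    using D2[OF that] U(1) that grad by (metis has_derivative_transform_within_open)
  have hess: "hessian f x = H x" if "x \<in> U" for x
    using frechet_derivative_at[OF D2'[OF that], symmetric]
    by (simp add: hessian_def jacobian_def)
  show "hessian f x0 = H x0"
    using hess U by blast
  have "continuous_on U (hessian f)"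
    using cont hess by (simp cong: continuous_on_cong)
  moreover have "f differentiable_on U" "gradient f differentiable_on U"
    using D1 D2' differentiable_def differentiable_on_eq_differentiable_at[OF U(1)] by blast+
  ultimately show "C2_near f x0"
    unfolding C2_near_def using U by blast
qed

lemma C2_near_realE:
  assumes "C2_near_real f t0"
  obtains U where "open U" "t0 \<in> U"
    "\<And>t. t \<in> U \<Longrightarrow> (f has_real_derivative deriv f t) (at t)"
    "\<And>t. t \<in> U \<Longrightarrow> (deriv f has_real_derivative deriv (deriv f) t) (at t)"
    "continuous_on U (deriv (deriv f))"
proof -
  obtain U where U: "open U" "t0 \<in> U" "f differentiable_on U" "deriv f differentiable_on U"
      "continuous_on U (deriv (deriv f))"
    using assms unfolding C2_near_real_def by blast
  show thesis
  proof
    fix t assume "t \<in> U"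
    then have "f differentiable at t" "deriv f differentiable at t"
      using U differentiable_on_eq_differentiable_at by blast+
    then show "(f has_real_derivative deriv f t) (at t)"
        "(deriv f has_real_derivative deriv (deriv f) t) (at t)"
      using DERIV_deriv_iff_real_differentiable by blast+
  qed (use U in auto)
qed

lemma C2_near_realI:
  assumes U: "open U" "t0 \<in> U"
    and D1: "\<And>t. t \<in> U \<Longrightarrow> (f has_real_derivative f' t) (at t)"
    and D2: "\<And>t. t \<in> U \<Longrightarrow> (f' has_real_derivative f'' t) (at t)"
    and cont: "continuous_on U f''"
  shows "C2_near_real f t0" "deriv f t0 = f' t0" "deriv (deriv f) t0 = f'' t0"
proof -
  have d1: "deriv f t = f' t" if "t \<in> U" for t
    using D1 DERIV_imp_deriv that by blast
  have D2': "(deriv f has_real_derivative f'' t) (at t)" if "t \<in> U" for t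
    using D2[OF that] U(1) that d1 has_field_derivative_transform_within_open by metis
  have d2: "deriv (deriv f) t = f'' t" if "t \<in> U" for t
    using D2' DERIV_imp_deriv that by blast
  show "deriv f t0 = f' t0" "deriv (deriv f) t0 = f'' t0"
    using d1 d2 U by blast+
  have "continuous_on U (deriv (deriv f))"
    using cont d2 by (simp cong: continuous_on_cong)
  moreover have "f differentiable_on U" "deriv f differentiable_on U"
    using D1 D2' differentiable_on_eq_differentiable_at[OF U(1)] real_differentiable_def by blast+
  ultimately show "C2_near_real f t0"
    unfolding C2_near_real_def using U by blast
qed

lemma continuous_on_matrix_vector_mult:
  fixes A :: "'a::topological_space \<Rightarrow> real^'n^'m"
  assumes "continuous_on S A" "continuous_on S v"
  shows "continuous_on S (\<lambda>x. A x *v v x)"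
  unfolding matrix_vector_mult_def by (intro continuous_intros assms)

lemma symmetric_matrix_inner:
  fixes A :: "real^'n^'n"
  assumes "transpose A = A"
  shows "u \<bullet> (A *v v) = v \<bullet> (A *v u)"
  by (metis assms dot_lmul_matrix inner_commute transpose_matrix_vector)

lemma symmetric_matrixI:
  fixes A :: "real^'n^'n"
  assumes "\<And>u v. u \<bullet> (A *v v) = v \<bullet> (A *v u)"
  shows "transpose A = A"
proof -
  have "transpose A *v u = A *v u" for u
    by (rule vector_eq_rdot[THEN iffD1])
       (metis assms dot_lmul_matrix inner_commute transpose_matrix_vector)
  then show ?thesis
    by (simp add: matrix_eq)
qed

section \<open>Symmetry of the Hessian\<close>

text \<open>The mean value theorem is applied first in the direction \<open>u\<close>, to the difference of \<open>f\<close> along two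
  parallel segments, and then in the direction \<open>v\<close>, to \<open>G \<bullet> u\<close>.\<close>

lemma second_difference_mean_value:
  fixes f :: "real^'n \<Rightarrow> real"
  assumes D1: "\<And>y. y \<in> ball x r \<Longrightarrow> (f has_derivative (\<lambda>h. G y \<bullet> h)) (at y)"
    and D2: "\<And>y. y \<in> ball x r \<Longrightarrow> (G has_derivative (\<lambda>h. H y *v h)) (at y)"
    and r: "norm u + norm v < r"
  obtains y where "dist x y \<le> norm u + norm v"
    "f (x + u + v) - f (x + u) - f (x + v) + f x = u \<bullet> (H y *v v)"
proof -
  have inball: "x + s *\<^sub>R u + t *\<^sub>R v \<in> cball x (norm u + norm v)"
    if "0 \<le> s" "s \<le> 1" "0 \<le> t" "t \<le> 1" for s t
  proof -
    have "norm (s *\<^sub>R u + t *\<^sub>R v) \<le> s * norm u + t * norm v"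
      using that norm_triangle_ineq[of "s *\<^sub>R u" "t *\<^sub>R v"] by simp
    also have "\<dots> \<le> 1 * norm u + 1 * norm v"
      using that by (intro add_mono mult_right_mono) auto
    finally show ?thesis
      by (simp add: dist_norm norm_minus_commute algebra_simps)
  qed
  then have inball': "x + s *\<^sub>R u + t *\<^sub>R v \<in> ball x r"
    if "0 \<le> s" "s \<le> 1" "0 \<le> t" "t \<le> 1" for s t
    using that r by (meson le_less_trans mem_ball mem_cball)
  define p where "p s = f (x + s *\<^sub>R u + 1 *\<^sub>R v) - f (x + s *\<^sub>R u + 0 *\<^sub>R v)" for s
  have "\<exists>s. 0 < s \<and> s < 1 \<and> p 1 - p 0 =
      (1 - 0) * (G (x + s *\<^sub>R u + 1 *\<^sub>R v) \<bullet> u - G (x + s *\<^sub>R u + 0 *\<^sub>R v) \<bullet> u)"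
    unfolding p_def
  proof (rule MVT2)
    fix s :: real assume s: "0 \<le> s" "s \<le> 1"
    have "((\<lambda>s. f (x + s *\<^sub>R u + c *\<^sub>R v)) has_real_derivative
        G (x + s *\<^sub>R u + c *\<^sub>R v) \<bullet> u) (at s)" if "0 \<le> c" "c \<le> 1" for c
    proof -
      have "((\<lambda>s. x + s *\<^sub>R u + c *\<^sub>R v) has_derivative (\<lambda>h. h *\<^sub>R u)) (at s)"
        by (auto intro!: derivative_eq_intros)
      from has_derivative_compose[OF this D1[OF inball'[OF s that]]]
      show ?thesis
        by (simp add: has_field_derivative_def mult_commute_abs)
    qed
    from DERIV_diff[OF this[of 1] this[of 0]]
    show "((\<lambda>s. f (x + s *\<^sub>R u + 1 *\<^sub>R v) - f (x + s *\<^sub>R u + 0 *\<^sub>R v)) has_real_derivative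
        G (x + s *\<^sub>R u + 1 *\<^sub>R v) \<bullet> u - G (x + s *\<^sub>R u + 0 *\<^sub>R v) \<bullet> u) (at s)"
      by simp
  qed auto
  then obtain s where s: "0 < s" "s < 1"
      and ps: "p 1 - p 0 = G (x + s *\<^sub>R u + 1 *\<^sub>R v) \<bullet> u - G (x + s *\<^sub>R u + 0 *\<^sub>R v) \<bullet> u"
    by auto
  have "\<exists>t. 0 < t \<and> t < 1 \<and>
      G (x + s *\<^sub>R u + 1 *\<^sub>R v) \<bullet> u - G (x + s *\<^sub>R u + 0 *\<^sub>R v) \<bullet> u
        = (1 - 0) * ((H (x + s *\<^sub>R u + t *\<^sub>R v) *v v) \<bullet> u)"
  proof (rule MVT2)
    fix t :: real assume t: "0 \<le> t" "t \<le> 1"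
    have "((\<lambda>t. x + s *\<^sub>R u + t *\<^sub>R v) has_derivative (\<lambda>h. h *\<^sub>R v)) (at t)"
      by (auto intro!: derivative_eq_intros)
    from has_derivative_compose[OF this D2[OF inball'[of s t]]]
    have "((\<lambda>t. G (x + s *\<^sub>R u + t *\<^sub>R v)) has_derivative
        (\<lambda>h. H (x + s *\<^sub>R u + t *\<^sub>R v) *v (h *\<^sub>R v))) (at t)"
      using s t by simp
    then show "((\<lambda>t. G (x + s *\<^sub>R u + t *\<^sub>R v) \<bullet> u) has_real_derivative
        (H (x + s *\<^sub>R u + t *\<^sub>R v) *v v) \<bullet> u) (at t)"
      unfolding has_field_derivative_def
      by (auto intro!: derivative_eq_intros simp: fun_eq_iff matrix_vector_mult_scaleR)
  qed auto
  then obtain t where t: "0 < t" "t < 1"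
      and st: "p 1 - p 0 = (H (x + s *\<^sub>R u + t *\<^sub>R v) *v v) \<bullet> u"
    using ps by auto
  show thesis
  proof
    show "dist x (x + s *\<^sub>R u + t *\<^sub>R v) \<le> norm u + norm v"
      using inball[of s t] s t by simp
    show "f (x + u + v) - f (x + u) - f (x + v) + f x = u \<bullet> (H (x + s *\<^sub>R u + t *\<^sub>R v) *v v)"
      using st by (simp add: p_def inner_commute)
  qed
qed

text \<open>The second difference is symmetric in the two increments \<open>s u\<close>, \<open>s v\<close>, and divided by \<open>s\<^sup>2\<close> it
  tends to \<open>u \<bullet> H v\<close>; exchanging the roles of \<open>u\<close> and \<open>v\<close> gives the other limit \<open>v \<bullet> H u\<close>.
  Symmetry matters here because positive semidefiniteness is only meant for symmetric matrices.\<close>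

lemma hessian_symmetric:
  fixes f :: "real^'n \<Rightarrow> real"
  assumes "C2_near f x"
  shows "transpose (hessian f x) = hessian f x"
proof (rule symmetric_matrixI)
  fix u v :: "real^'n"
  obtain U where U: "open U" "x \<in> U"
    and D1: "\<And>y. y \<in> U \<Longrightarrow> (f has_derivative (\<lambda>h. gradient f y \<bullet> h)) (at y)"
    and D2: "\<And>y. y \<in> U \<Longrightarrow> (gradient f has_derivative (\<lambda>h. hessian f y *v h)) (at y)"
    and cont: "continuous_on U (hessian f)"
    using assms by (rule C2_nearE) blast
  obtain r where r: "r > 0" "ball x r \<subseteq> U"
    using U openE by blast
  \<comment> \<open>With \<open>s n * N < r\<close> the parallelogram spanned by \<open>s n u\<close> and \<open>s n v\<close> stays inside the ball.\<close>
  define N where "N = norm u + norm v + 1"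
  define s where "s n = (r / N) * inverse (real (Suc (Suc n)))" for n
  have N: "N > 0" "norm u + norm v < N"
    unfolding N_def using norm_ge_zero[of u] norm_ge_zero[of v] by linarith+
  have s_pos: "s n > 0" for n
    unfolding s_def using r N by simp
  have small: "s n * N < r" for n
  proof -
    have "s n * N = r * inverse (real (Suc (Suc n)))"
      using N by (simp add: s_def)
    also have "\<dots> < r * 1"
      using r by (intro mult_strict_left_mono) (simp_all add: inverse_less_1_iff)
    finally show ?thesis by simp
  qed
  have s_lim: "(\<lambda>n. s n * N) \<longlonglongrightarrow> 0"
  proof -
    have "(\<lambda>n. (r / N) * inverse (real (Suc (Suc n))) * N) \<longlonglongrightarrow> (r / N) * 0 * N"
      by (intro tendsto_intros LIMSEQ_Suc[OF LIMSEQ_inverse_real_of_nat])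
    then show ?thesis
      unfolding s_def by simp
  qed
  define d where "d n = f (x + s n *\<^sub>R u + s n *\<^sub>R v) - f (x + s n *\<^sub>R u) - f (x + s n *\<^sub>R v) + f x" for n
  have main: "(\<lambda>n. d n / (s n)\<^sup>2) \<longlonglongrightarrow> a \<bullet> (hessian f x *v b)"
    if ab: "\<And>n. d n = f (x + s n *\<^sub>R a + s n *\<^sub>R b) - f (x + s n *\<^sub>R a) - f (x + s n *\<^sub>R b) + f x"
      "norm a + norm b < N" for a b
  proof -
    have "\<exists>y. dist x y \<le> s n * N \<and> d n = (s n *\<^sub>R a) \<bullet> (hessian f y *v (s n *\<^sub>R b))" for n
    proof -
      have le: "norm (s n *\<^sub>R a) + norm (s n *\<^sub>R b) \<le> s n * N"
        using s_pos[of n] ab(2) by (simp flip: distrib_left)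
      then have lt: "norm (s n *\<^sub>R a) + norm (s n *\<^sub>R b) < r"
        using small[of n] by linarith
      obtain y where "dist x y \<le> norm (s n *\<^sub>R a) + norm (s n *\<^sub>R b)"
        "f (x + s n *\<^sub>R a + s n *\<^sub>R b) - f (x + s n *\<^sub>R a) - f (x + s n *\<^sub>R b) + f x
           = (s n *\<^sub>R a) \<bullet> (hessian f y *v (s n *\<^sub>R b))"
        using second_difference_mean_value[of x r f "gradient f" "hessian f", OF _ _ lt] D1 D2 r(2)
        by blast
      then show ?thesis
        using le ab(1) by (intro exI[of _ y]) auto
    qed
    then obtain y where y: "\<And>n. dist x (y n) \<le> s n * N"
      and dy: "\<And>n. d n = (s n *\<^sub>R a) \<bullet> (hessian f (y n) *v (s n *\<^sub>R b))"
      by metis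
    have "(\<lambda>n. dist (y n) x) \<longlonglongrightarrow> 0"
      by (rule tendsto_sandwich[OF _ _ tendsto_const s_lim])
         (use y in \<open>auto simp: dist_commute\<close>)
    then have "y \<longlonglongrightarrow> x"
      using tendsto_dist_iff by blast
    moreover have "isCont (\<lambda>z. a \<bullet> (hessian f z *v b)) x"
    proof -
      have "continuous_on U (\<lambda>z. a \<bullet> (hessian f z *v b))"
        by (intro continuous_intros continuous_on_matrix_vector_mult cont)
      then show ?thesis
        using U continuous_on_eq_continuous_at by blast
    qed
    ultimately have "(\<lambda>n. a \<bullet> (hessian f (y n) *v b)) \<longlonglongrightarrow> a \<bullet> (hessian f x *v b)"
      using isCont_tendsto_compose by blast
    moreover have "d n / (s n)\<^sup>2 = a \<bullet> (hessian f (y n) *v b)" for n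
      using dy[of n] s_pos[of n] by (simp add: matrix_vector_mult_scaleR power2_eq_square)
    ultimately show ?thesis
      by simp
  qed
  have "(\<lambda>n. d n / (s n)\<^sup>2) \<longlonglongrightarrow> u \<bullet> (hessian f x *v v)"
    by (rule main) (use N in \<open>auto simp: d_def\<close>)
  moreover have "(\<lambda>n. d n / (s n)\<^sup>2) \<longlonglongrightarrow> v \<bullet> (hessian f x *v u)"
    by (rule main) (use N in \<open>auto simp: d_def algebra_simps\<close>)
  ultimately show "u \<bullet> (hessian f x *v v) = v \<bullet> (hessian f x *v u)"
    using LIMSEQ_unique by blast
qed

section \<open>Completing the square\<close>

lemma proj_line_mult [simp]: "proj_line e *v x = (x \<bullet> e) *\<^sub>R e"
proof -
  have "linear (\<lambda>x. (x \<bullet> e) *\<^sub>R e)"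
    by (intro linearI) (simp_all add: inner_add_left scaleR_add_left)
  then show ?thesis
    unfolding proj_line_def by simp
qed

lemma proj_perp_mult [simp]: "proj_perp e *v x = x - (x \<bullet> e) *\<^sub>R e"
  by (simp add: proj_perp_def matrix_vector_mult_diff_rdistrib)

lemma proj_line_nth: "proj_line e $ i $ j = e $ i * e $ j"
  by (simp add: proj_line_def matrix_def inner_axis' mult.commute)

lemma continuous_on_proj_line:
  assumes "continuous_on S e"
  shows "continuous_on S (\<lambda>x. proj_line (e x))"
proof -
  have "proj_line (e x) = (\<chi> i j. e x $ i * e x $ j)" for x
    by (simp add: vec_eq_iff proj_line_nth)
  then show ?thesis
    by (simp add: continuous_intros assms)
qed

text \<open>Write \<open>C = H - \<mu>\<close> for the form on the hyperplane orthogonal to \<open>e\<close>; by assumption \<open>C \<ge> 0\<close>, so \<open>C + \<epsilon>\<close> is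
  invertible there. Let \<open>v\<close> solve \<open>(C + \<epsilon>) v = - (I - P\<^sub>e) H e\<close>, which is the equation of the critical point of
  \<open>(e + v) \<bullet> H (e + v) - \<mu> |v|\<^sup>2 + \<epsilon> |v|\<^sup>2\<close>. For this \<open>v\<close> the quadratic form of the matrix in the
  conclusion, evaluated at \<open>c e + z\<close> with \<open>z \<bottom> e\<close>, becomes
  \<open>(C + \<epsilon>)(z - c v) + \<epsilon> c\<^sup>2 (1 + |v|\<^sup>2)\<close>, a sum of nonnegative terms.\<close>

lemma radial_matrix_below_perturbation:
  fixes H :: "real^'n^'n"
  assumes sym: "transpose H = H" and e: "norm e = 1" and \<epsilon>: "\<epsilon> > 0"
    and perp: "\<And>v. v \<bullet> e = 0 \<Longrightarrow> \<mu> * (v \<bullet> v) \<le> v \<bullet> (H *v v)"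
  obtains v where "v \<bullet> e = 0"
    "H + \<epsilon> *\<^sub>R mat 1 - (\<mu> *\<^sub>R proj_perp e + ((e + v) \<bullet> (H *v (e + v)) - \<mu> * (v \<bullet> v)) *\<^sub>R proj_line e)
       \<in> psd_matrices"
proof -
  have ee: "e \<bullet> e = 1"
    using e by (simp add: norm_eq_1)
  define P where "P x = x - (x \<bullet> e) *\<^sub>R e" for x
  have P_perp: "P x \<bullet> e = 0" for x
    by (simp add: P_def inner_diff_left ee)
  have P_inner: "P x \<bullet> y = x \<bullet> P y" for x y
    by (simp add: P_def algebra_simps inner_commute)
  have P_id: "P x = x" if "x \<bullet> e = 0" for x
    by (simp add: P_def that)
  have P_idem: "P (P x) = P x" for x
    by (rule P_id[OF P_perp])
  have linP: "linear P"
    unfolding P_def by (intro linearI) (simp_all add: algebra_simps inner_add_left)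
  \<comment> \<open>\<open>N\<close> extends \<open>C + \<epsilon>\<close> from the hyperplane to the whole space, by \<open>\<epsilon>\<close> on the line of \<open>e\<close>. It is
      positive definite, so the critical point can be found without restricting to a subspace.\<close>
  define N where "N x = P (H *v P x) - \<mu> *\<^sub>R P x + \<epsilon> *\<^sub>R x" for x
  have linN: "linear N"
    unfolding N_def
    by (intro linearI)
      (simp_all add: linear_add[OF linP] linear_scale[OF linP] matrix_vector_right_distrib
        matrix_vector_mult_scaleR algebra_simps)
  have N_inner: "z \<bullet> N x = P z \<bullet> (H *v P x) - \<mu> * (P z \<bullet> P x) + \<epsilon> * (z \<bullet> x)" for z x
    by (simp add: N_def inner_add_right inner_diff_right P_inner P_idem)
  have N_ge: "\<epsilon> * (x \<bullet> x) \<le> x \<bullet> N x" for x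
    using perp[OF P_perp[of x]] by (simp add: N_inner)
  have "inj N"
  proof (rule linear_injective_0[THEN iffD2, OF linN, rule_format])
    fix x assume "N x = 0"
    then have "\<epsilon> * (x \<bullet> x) \<le> 0"
      using N_ge[of x] by simp
    then have "x \<bullet> x \<le> 0"
      using \<epsilon> by (simp add: mult_le_0_iff)
    then show "x = 0" by (metis inner_gt_zero_iff not_le)
  qed
  then obtain v where v: "N v = - P (H *v e)"
    using linear_injective_imp_surjective[OF linN] by (metis surjD)
  \<comment> \<open>As \<open>N\<close> preserves the splitting of the space, the solution lies in the hyperplane.\<close>
  have "\<epsilon> * (e \<bullet> v) = 0"
  proof -
    have "P e = 0" by (simp add: P_def ee)
    then have "e \<bullet> N v = \<epsilon> * (e \<bullet> v)" by (simp add: N_inner)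
    moreover have "e \<bullet> N v = 0"
      using P_perp[of "H *v e"] by (simp add: v inner_commute)
    ultimately show ?thesis by simp
  qed
  then have ve: "v \<bullet> e = 0"
    using \<epsilon> by (simp add: inner_commute)
  have crit: "z \<bullet> (H *v v) - \<mu> * (z \<bullet> v) + \<epsilon> * (z \<bullet> v) = - (z \<bullet> (H *v e))"
    if "z \<bullet> e = 0" for z
    using N_inner[of z v] v P_inner[of z] that ve by (simp add: P_id)
  define a where "a = (e + v) \<bullet> (H *v (e + v)) - \<mu> * (v \<bullet> v)"
  define M where "M = H + \<epsilon> *\<^sub>R mat 1 - (\<mu> *\<^sub>R proj_perp e + a *\<^sub>R proj_line e)"
  have M_mult: "M *v x = H *v x + \<epsilon> *\<^sub>R x - (\<mu> *\<^sub>R P x + (a * (x \<bullet> e)) *\<^sub>R e)" for x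
    unfolding M_def
    by (simp add: matrix_vector_mult_diff_rdistrib matrix_vector_mult_add_rdistrib P_def
        scaleR_matrix_vector_assoc[symmetric])
  have Hsym: "x \<bullet> (H *v y) = y \<bullet> (H *v x)" for x y
    using symmetric_matrix_inner[OF sym] .
  have "transpose M = M"
  proof (rule symmetric_matrixI)
    fix x y
    show "x \<bullet> (M *v y) = y \<bullet> (M *v x)"
      using Hsym[of x y] P_inner[of x y]
      by (simp add: M_mult inner_add_right inner_diff_right inner_commute mult.commute)
  qed
  moreover have "0 \<le> x \<bullet> (M *v x)" for x
  proof -
    define c z where "c = x \<bullet> e" and "z = P x"
    have ze: "z \<bullet> e = 0"
      by (simp add: z_def P_perp)
    have x: "x = c *\<^sub>R e + z"
      by (simp add: c_def z_def P_def)
    have xHx: "x \<bullet> (H *v x) = c\<^sup>2 * (e \<bullet> (H *v e)) + 2 * c * (z \<bullet> (H *v e)) + z \<bullet> (H *v z)"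
      using Hsym[of e z] unfolding x
      by (simp add: matrix_vector_right_distrib matrix_vector_mult_scaleR inner_add_left
          inner_add_right power2_eq_square algebra_simps)
    have xx: "x \<bullet> x = c\<^sup>2 + z \<bullet> z"
      using ze unfolding x
      by (simp add: inner_add_left inner_add_right ee inner_commute power2_eq_square)
    have aa: "a = e \<bullet> (H *v e) + 2 * (v \<bullet> (H *v e)) + v \<bullet> (H *v v) - \<mu> * (v \<bullet> v)"
      using Hsym[of e v] unfolding a_def
      by (simp add: matrix_vector_right_distrib inner_add_left inner_add_right)
    have "x \<bullet> P x = z \<bullet> z"
      using ze unfolding z_def[symmetric]
      by (subst x) (simp add: inner_add_left inner_add_right inner_commute)
    then have q: "x \<bullet> (M *v x) = x \<bullet> (H *v x) + \<epsilon> * (x \<bullet> x) - \<mu> * (z \<bullet> z) - a * c\<^sup>2"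
      by (simp add: M_mult inner_add_right inner_diff_right c_def power2_eq_square)
    define w where "w = z - c *\<^sub>R v"
    have we: "w \<bullet> e = 0"
      by (simp add: w_def inner_diff_left ze ve)
    have wHw: "w \<bullet> (H *v w) = z \<bullet> (H *v z) - 2 * c * (z \<bullet> (H *v v)) + c\<^sup>2 * (v \<bullet> (H *v v))"
      using Hsym[of v z] unfolding w_def
      by (simp add: matrix_vector_mult_diff_distrib matrix_vector_mult_scaleR inner_diff_left
          inner_diff_right power2_eq_square algebra_simps)
    have ww: "w \<bullet> w = z \<bullet> z - 2 * c * (z \<bullet> v) + c\<^sup>2 * (v \<bullet> v)"
      unfolding w_def
      by (simp add: inner_diff_left inner_diff_right power2_eq_square inner_commute algebra_simps)
    have zHe: "z \<bullet> (H *v e) = - (z \<bullet> (H *v v) - \<mu> * (z \<bullet> v) + \<epsilon> * (z \<bullet> v))"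
      using crit[OF ze] by simp
    have vHe: "v \<bullet> (H *v e) = - (v \<bullet> (H *v v) - \<mu> * (v \<bullet> v) + \<epsilon> * (v \<bullet> v))"
      using crit[OF ve] by simp
    have "x \<bullet> (M *v x)
        = (w \<bullet> (H *v w) - \<mu> * (w \<bullet> w)) + \<epsilon> * (w \<bullet> w) + \<epsilon> * c\<^sup>2 * (1 + v \<bullet> v)"
      unfolding q xHx xx aa zHe vHe wHw ww by (simp add: algebra_simps)
    also have "\<dots> \<ge> 0"
      using perp[OF we] \<epsilon> by (intro add_nonneg_nonneg mult_nonneg_nonneg) auto
    finally show ?thesis .
  qed
  ultimately have "M \<in> psd_matrices"
    by (simp add: psd_matrices_def sym_matrices_def)
  then show thesis
    using that ve unfolding M_def a_def by blast
qed

section \<open>Restriction to curves\<close>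

lemma second_derivative_nonneg_at_local_min:
  assumes "C2_near_real g t0" and min: "\<forall>\<^sub>F t in nhds t0. g t0 \<le> g t"
  shows "deriv g t0 = 0" "0 \<le> deriv (deriv g) t0"
proof -
  obtain U where U: "open U" "t0 \<in> U"
    and D1: "\<And>t. t \<in> U \<Longrightarrow> (g has_real_derivative deriv g t) (at t)"
    and D2: "\<And>t. t \<in> U \<Longrightarrow> (deriv g has_real_derivative deriv (deriv g) t) (at t)"
    using assms(1) by (rule C2_near_realE) blast
  have "\<forall>\<^sub>F t in nhds t0. t \<in> U \<and> g t0 \<le> g t"
    using min eventually_nhds_in_open[OF U] by eventually_elim blast
  then obtain d where d: "d > 0" "\<And>t. dist t t0 < d \<Longrightarrow> t \<in> U \<and> g t0 \<le> g t"
    unfolding eventually_nhds_metric by blast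
  show g': "deriv g t0 = 0"
    by (rule DERIV_local_min[OF D1[OF U(2)] d(1)]) (use d in \<open>auto simp: dist_real_def abs_minus_commute\<close>)
  show "0 \<le> deriv (deriv g) t0"
  proof (rule ccontr)
    assume "\<not> 0 \<le> deriv (deriv g) t0"
    then obtain d' where d': "d' > 0" "\<And>h. 0 < h \<Longrightarrow> h < d' \<Longrightarrow> deriv g (t0 + h) < 0"
      using DERIV_neg_dec_right[OF D2[OF U(2)]] g' by auto
    define h where "h = min d d' / 2"
    have h: "0 < h" "h < d" "h < d'"
      unfolding h_def using d d' by auto
    obtain z where z: "t0 < z" "z < t0 + h" "g (t0 + h) - g t0 = (t0 + h - t0) * deriv g z"
      using MVT2[of t0 "t0 + h" g "deriv g"] D1 d(2) h by (auto simp: dist_real_def)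
    have "deriv g z < 0"
      using d'(2)[of "z - t0"] z h by simp
    then have "g (t0 + h) < g t0"
      using z h by (simp add: mult_pos_neg algebra_simps)
    then show False
      using d(2)[of "t0 + h"] h by (simp add: dist_real_def)
  qed
qed

lemma C2_near_real_compose_curve:
  fixes \<phi> :: "real^'n \<Rightarrow> real"
  assumes \<phi>: "C2_near \<phi> (c t0)"
    and c': "\<And>t. (c has_vector_derivative c' t) (at t)"
    and c'': "\<And>t. (c' has_vector_derivative c'' t) (at t)"
    and cont: "continuous_on UNIV c''"
  defines "g \<equiv> \<lambda>t. \<phi> (c t)"
  shows "C2_near_real g t0"
    and "deriv g t0 = gradient \<phi> (c t0) \<bullet> c' t0"
    and "deriv (deriv g) t0 = c' t0 \<bullet> (hessian \<phi> (c t0) *v c' t0) + gradient \<phi> (c t0) \<bullet> c'' t0"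
proof -
  obtain U where U: "open U" "c t0 \<in> U"
    and D1: "\<And>x. x \<in> U \<Longrightarrow> (\<phi> has_derivative (\<lambda>h. gradient \<phi> x \<bullet> h)) (at x)"
    and D2: "\<And>x. x \<in> U \<Longrightarrow> (gradient \<phi> has_derivative (\<lambda>h. hessian \<phi> x *v h)) (at x)"
    and contH: "continuous_on U (hessian \<phi>)"
    using \<phi> by (rule C2_nearE) blast
  have cont_c: "continuous_on A c" and cont_c': "continuous_on A c'" for A
    using has_vector_derivative_continuous[OF c'] has_vector_derivative_continuous[OF c'']
    by (simp_all add: continuous_at_imp_continuous_on)
  have op: "open (c -` U)"
    using cont_c[of UNIV] U(1) by (simp add: open_vimage)
  have g1: "(g has_real_derivative gradient \<phi> (c t) \<bullet> c' t) (at t)" if "t \<in> c -` U" for t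
  proof -
    have "(g has_derivative (\<lambda>h. gradient \<phi> (c t) \<bullet> (h *\<^sub>R c' t))) (at t)"
      unfolding g_def
      by (rule has_derivative_compose[OF c'[unfolded has_vector_derivative_def] D1]) (use that in auto)
    then show ?thesis
      by (simp add: has_field_derivative_def mult_commute_abs)
  qed
  have g2: "((\<lambda>t. gradient \<phi> (c t) \<bullet> c' t) has_real_derivative
      c' t \<bullet> (hessian \<phi> (c t) *v c' t) + gradient \<phi> (c t) \<bullet> c'' t) (at t)" if "t \<in> c -` U" for t
  proof -
    have "((\<lambda>t. gradient \<phi> (c t)) has_derivative (\<lambda>h. hessian \<phi> (c t) *v (h *\<^sub>R c' t))) (at t)"
      by (rule has_derivative_compose[OF c'[unfolded has_vector_derivative_def] D2]) (use that in auto)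
    from has_derivative_inner[OF this c''[unfolded has_vector_derivative_def]]
    show ?thesis
      unfolding has_field_derivative_def
      by (rule has_derivative_eq_rhs)
         (simp add: fun_eq_iff matrix_vector_mult_scaleR inner_commute algebra_simps)
  qed
  have "continuous_on (c -` U) (\<lambda>t. hessian \<phi> (c t))"
    by (rule continuous_on_compose2[OF contH cont_c]) auto
  moreover have "continuous_on U (gradient \<phi>)"
    using has_derivative_continuous[OF D2] by (simp add: continuous_at_imp_continuous_on)
  then have "continuous_on (c -` U) (\<lambda>t. gradient \<phi> (c t))"
    by (rule continuous_on_compose2[OF _ cont_c]) auto
  ultimately have cg2: "continuous_on (c -` U)
      (\<lambda>t. c' t \<bullet> (hessian \<phi> (c t) *v c' t) + gradient \<phi> (c t) \<bullet> c'' t)"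
    by (intro continuous_intros continuous_on_matrix_vector_mult cont_c'
        continuous_on_subset[OF cont]) auto
  have t0: "t0 \<in> c -` U"
    using U by simp
  note * = C2_near_realI[OF op t0 g1 g2 cg2]
  show "C2_near_real g t0" "deriv g t0 = gradient \<phi> (c t0) \<bullet> c' t0"
    "deriv (deriv g) t0 = c' t0 \<bullet> (hessian \<phi> (c t0) *v c' t0) + gradient \<phi> (c t0) \<bullet> c'' t0"
    using * by blast+
qed

text \<open>In the plane of \<open>e\<close> and \<open>w\<close>, the point with radius \<open>p + q t\<close> and angle \<open>k (t - t0)\<close>. The affine
  radius allows one computation for both uses: \<open>q = 0\<close> gives a great circle on a sphere, and
  \<open>p = 0\<close>, \<open>q = 1\<close> a spiral on which the norm is the parameter.\<close>

definition polar_curve :: "real^'n \<Rightarrow> real^'n \<Rightarrow> real \<Rightarrow> real \<Rightarrow> real \<Rightarrow> real \<Rightarrow> real \<Rightarrow> real^'n" where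
  "polar_curve e w k p q t0 t =
     (p + q * t) *\<^sub>R (cos (k * (t - t0)) *\<^sub>R e + sin (k * (t - t0)) *\<^sub>R w)"

text \<open>The alternative \<open>k = 0\<close> covers straight rays, for which \<open>w\<close> may be \<open>0\<close>; in dimension one there is
  no unit vector orthogonal to \<open>e\<close>.\<close>

lemma norm_polar_curve:
  assumes "norm e = 1" "w \<bullet> e = 0" "norm w = 1 \<or> k = 0"
  shows "norm (polar_curve e w k p q t0 t) = \<bar>p + q * t\<bar>"
proof -
  let ?\<theta> = "k * (t - t0)"
  have "(norm (cos ?\<theta> *\<^sub>R e + sin ?\<theta> *\<^sub>R w))\<^sup>2
      = (cos ?\<theta>)\<^sup>2 * (e \<bullet> e) + (sin ?\<theta>)\<^sup>2 * (w \<bullet> w)"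
    using assms(2) unfolding power2_norm_eq_inner
    by (simp add: inner_add_left inner_add_right inner_commute power2_eq_square)
  also have "\<dots> = (cos ?\<theta>)\<^sup>2 + (sin ?\<theta>)\<^sup>2"
    using assms(1,3) by (auto simp: norm_eq_1)
  finally have "norm (cos ?\<theta> *\<^sub>R e + sin ?\<theta> *\<^sub>R w) = 1"
    by (simp add: power2_eq_1_iff) (smt (verit) norm_ge_zero)
  then show ?thesis
    by (simp add: polar_curve_def)
qed

lemma C2_near_real_along_polar_curve:
  fixes \<phi> :: "real^'n \<Rightarrow> real" and e w :: "real^'n" and k p q t0 :: real
  defines "\<rho> \<equiv> p + q * t0"
  assumes \<phi>: "C2_near \<phi> (\<rho> *\<^sub>R e)"
  defines "g \<equiv> \<lambda>t. \<phi> (polar_curve e w k p q t0 t)"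
    and "d \<equiv> q *\<^sub>R e + (\<rho> * k) *\<^sub>R w"
  shows "C2_near_real g t0"
    and "deriv g t0 = gradient \<phi> (\<rho> *\<^sub>R e) \<bullet> d"
    and "deriv (deriv g) t0 = d \<bullet> (hessian \<phi> (\<rho> *\<^sub>R e) *v d)
      + gradient \<phi> (\<rho> *\<^sub>R e) \<bullet> ((2 * q * k) *\<^sub>R w - (\<rho> * k\<^sup>2) *\<^sub>R e)"
proof -
  \<comment> \<open>The rotating frame, whose derivatives are multiples of its own members.\<close>
  define A B where "A t = cos (k * (t - t0)) *\<^sub>R e + sin (k * (t - t0)) *\<^sub>R w"
    and "B t = cos (k * (t - t0)) *\<^sub>R w - sin (k * (t - t0)) *\<^sub>R e" for t
  have A': "(A has_vector_derivative k *\<^sub>R B t) (at t)"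
    and B': "(B has_vector_derivative - k *\<^sub>R A t) (at t)" for t
    unfolding A_def[abs_def] B_def[abs_def]
    by (auto intro!: derivative_eq_intros simp: vec_eq_iff algebra_simps)
  have AB0: "A t0 = e" "B t0 = w"
    by (simp_all add: A_def B_def)
  define c' where "c' t = q *\<^sub>R A t + ((p + q * t) * k) *\<^sub>R B t" for t
  define c'' where "c'' t = (2 * q * k) *\<^sub>R B t - ((p + q * t) * k\<^sup>2) *\<^sub>R A t" for t
  have "((\<lambda>t. (p + q * t) *\<^sub>R A t) has_vector_derivative c' t) (at t)" for t
    by (auto intro!: derivative_eq_intros A' simp: vec_eq_iff c'_def algebra_simps)
  then have "(polar_curve e w k p q t0 has_vector_derivative c' t) (at t)" for t
    unfolding polar_curve_def[abs_def] A_def .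
  moreover have "(c' has_vector_derivative c'' t) (at t)" for t
    unfolding c'_def[abs_def] c''_def
    by (auto intro!: derivative_eq_intros A' B' simp: vec_eq_iff algebra_simps power2_eq_square)
  moreover have "continuous_on UNIV c''"
    unfolding c''_def A_def B_def by (intro continuous_intros)
  moreover have c0: "polar_curve e w k p q t0 t0 = \<rho> *\<^sub>R e" "c' t0 = d"
      "c'' t0 = (2 * q * k) *\<^sub>R w - (\<rho> * k\<^sup>2) *\<^sub>R e"
    by (simp_all add: AB0 c'_def c''_def \<rho>_def d_def) (simp add: polar_curve_def)
  ultimately show "C2_near_real g t0"
    and "deriv g t0 = gradient \<phi> (\<rho> *\<^sub>R e) \<bullet> d"
    and "deriv (deriv g) t0 = d \<bullet> (hessian \<phi> (\<rho> *\<^sub>R e) *v d)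
      + gradient \<phi> (\<rho> *\<^sub>R e) \<bullet> ((2 * q * k) *\<^sub>R w - (\<rho> * k\<^sup>2) *\<^sub>R e)"
    using C2_near_real_compose_curve[of \<phi> "polar_curve e w k p q t0" t0 c' c''] \<phi>
    unfolding g_def by simp_all
qed

lemma tendsto_polar_curve:
  "(polar_curve e w k p q t0 \<longlongrightarrow> (p + q * t0) *\<^sub>R e) (nhds t0)"
proof -
  have "continuous_on UNIV (polar_curve e w k p q t0)"
    unfolding polar_curve_def[abs_def] by (intro continuous_intros)
  then have "isCont (polar_curve e w k p q t0) t0"
    by (simp add: continuous_on_eq_continuous_at)
  moreover have "polar_curve e w k p q t0 t0 = (p + q * t0) *\<^sub>R e"
    by (simp add: polar_curve_def)
  ultimately show ?thesis
    by (metis isCont_def tendsto_at_iff_tendsto_nhds)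
qed

section \<open>Radial functions\<close>

text \<open>The gradient is \<open>(\<phi>'(t)/t) x\<close> with \<open>t = |x|\<close>. Its derivative scales tangential directions by
  \<open>\<phi>'(t)/t\<close>, whereas in the radial direction the factor \<open>t\<close> cancels and \<open>\<phi>''(t)\<close> remains.\<close>

lemma C2_near_radial:
  fixes \<phi> :: "real \<Rightarrow> real" and x0 :: "real^'n"
  assumes \<phi>: "C2_near_real \<phi> (norm x0)" and x0: "x0 \<noteq> 0"
  defines "t \<equiv> norm x0"
  shows "C2_near (\<lambda>x. \<phi> (norm x)) x0"
    and "hessian (\<lambda>x. \<phi> (norm x)) x0 =
      (deriv \<phi> t / t) *\<^sub>R proj_perp (sgn x0) + deriv (deriv \<phi>) t *\<^sub>R proj_line (sgn x0)"
proof -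
  obtain U where U: "open U" "norm x0 \<in> U"
    and D1: "\<And>t. t \<in> U \<Longrightarrow> (\<phi> has_real_derivative deriv \<phi> t) (at t)"
    and D2: "\<And>t. t \<in> U \<Longrightarrow> (deriv \<phi> has_real_derivative deriv (deriv \<phi>) t) (at t)"
    and cont: "continuous_on U (deriv (deriv \<phi>))"
    using \<phi> by (rule C2_near_realE) blast
  define V :: "(real^'n) set" where "V = norm -` U - {0}"
  have V: "open V" "x0 \<in> V"
    unfolding V_def using U x0 by (auto intro!: open_Diff open_vimage continuous_intros)
  define G where "G x = (deriv \<phi> (norm x) / norm x) *\<^sub>R x" for x :: "real^'n"
  define H where "H x = (deriv \<phi> (norm x) / norm x) *\<^sub>R proj_perp (sgn x)
      + deriv (deriv \<phi>) (norm x) *\<^sub>R proj_line (sgn x)" for x :: "real^'n"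
  have norm': "(norm has_derivative (\<lambda>h. sgn x \<bullet> h)) (at x)" if "x \<in> V" for x
    using that has_derivative_norm[of x] unfolding V_def
    by (simp add: inner_commute)
  have "((\<lambda>x. \<phi> (norm x)) has_derivative (\<lambda>h. G x \<bullet> h)) (at x)" if x: "x \<in> V" for x
  proof -
    have "((\<lambda>x. \<phi> (norm x)) has_derivative (\<lambda>h. deriv \<phi> (norm x) * (sgn x \<bullet> h))) (at x)"
      by (rule has_derivative_compose[OF norm'[OF x] D1[unfolded has_field_derivative_def]])
         (use x V_def in auto)
    then show ?thesis
      by (simp add: G_def sgn_div_norm divide_inverse mult.assoc)
  qed
  moreover have "(G has_derivative (\<lambda>h. H x *v h)) (at x)" if x: "x \<in> V" for x
  proof -
    have nx: "norm x \<noteq> 0"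
      using x by (simp add: V_def)
    have "((\<lambda>x. deriv \<phi> (norm x)) has_derivative
        (\<lambda>h. deriv (deriv \<phi>) (norm x) * (sgn x \<bullet> h))) (at x)"
      by (rule has_derivative_compose[OF norm'[OF x] D2[unfolded has_field_derivative_def]])
         (use x V_def in auto)
    from has_derivative_scaleR[OF has_derivative_divide'[OF this norm'[OF x] nx] has_derivative_ident]
    have "(G has_derivative (\<lambda>h. (deriv \<phi> (norm x) / norm x) *\<^sub>R h +
        ((deriv (deriv \<phi>) (norm x) * (sgn x \<bullet> h) * norm x
          - deriv \<phi> (norm x) * (sgn x \<bullet> h)) / (norm x * norm x)) *\<^sub>R x)) (at x)"
      unfolding G_def .
    moreover have "(deriv \<phi> (norm x) / norm x) *\<^sub>R h +
        ((deriv (deriv \<phi>) (norm x) * (sgn x \<bullet> h) * norm x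
          - deriv \<phi> (norm x) * (sgn x \<bullet> h)) / (norm x * norm x)) *\<^sub>R x = H x *v h" for h
    proof -
      have to_sgn: "r *\<^sub>R x = (r * norm x) *\<^sub>R sgn x" for r
        using nx by (simp add: sgn_div_norm)
      have "((deriv (deriv \<phi>) (norm x) * (sgn x \<bullet> h) * norm x
          - deriv \<phi> (norm x) * (sgn x \<bullet> h)) / (norm x * norm x)) *\<^sub>R x
        = ((deriv (deriv \<phi>) (norm x) - deriv \<phi> (norm x) / norm x) * (sgn x \<bullet> h)) *\<^sub>R sgn x"
        unfolding to_sgn using nx by (simp add: field_simps)
      then show ?thesis
        by (simp add: H_def matrix_vector_mult_add_rdistrib scaleR_matrix_vector_assoc[symmetric]
            inner_commute algebra_simps)
    qed
    ultimately show ?thesis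
      by simp
  qed
  moreover have "continuous_on V H"
  proof -
    have maps: "norm ` V \<subseteq> U" and nz: "\<forall>x\<in>V. norm x \<noteq> 0"
      by (auto simp: V_def)
    have "continuous_on U (deriv \<phi>)"
      using DERIV_isCont[OF D2] by (simp add: continuous_at_imp_continuous_on)
    then have c1: "continuous_on V (\<lambda>x. deriv \<phi> (norm x))"
      by (rule continuous_on_compose2[OF _ _ maps]) (intro continuous_intros)
    have c2: "continuous_on V (\<lambda>x. deriv (deriv \<phi>) (norm x))"
      by (rule continuous_on_compose2[OF cont _ maps]) (intro continuous_intros)
    have c3: "continuous_on V (\<lambda>x. proj_line (sgn x))"
      by (rule continuous_on_proj_line) (use nz in \<open>auto intro!: continuous_intros\<close>)
    show ?thesis
      unfolding H_def proj_perp_def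
      by (intro continuous_intros c1 c2 c3) (use nz in auto)
  qed
  ultimately show "C2_near (\<lambda>x. \<phi> (norm x)) x0"
    and "hessian (\<lambda>x. \<phi> (norm x)) x0 =
      (deriv \<phi> t / t) *\<^sub>R proj_perp (sgn x0) + deriv (deriv \<phi>) t *\<^sub>R proj_line (sgn x0)"
    using C2_nearI[OF V, of "\<lambda>x. \<phi> (norm x)" G H] unfolding t_def H_def by blast+
qed

lemma touches_above_compose_norm:
  fixes x0 :: "'a::real_normed_vector"
  assumes "touches_above \<phi> \<psi> (norm x0)"
  shows "touches_above (\<lambda>x. \<phi> (norm x)) (\<lambda>x. \<psi> (norm x)) x0"
proof -
  have "(norm \<longlongrightarrow> norm x0) (nhds x0)"
    by (intro tendsto_norm filterlim_ident)
  then show ?thesis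
    using assms unfolding touches_above_def by (auto intro: eventually_compose_filterlim)
qed

section \<open>Upper semi-continuity and monotonicity\<close>

text \<open>If no value were the largest, the sublevel sets \<open>{f < f x}\<close> would be an open cover of \<open>K\<close>; a finite
  subcover misses the point with the largest of the finitely many values \<open>f x\<close>.\<close>

lemma usc_attains_sup:
  fixes f :: "'a::topological_space \<Rightarrow> ereal"
  assumes "usc_on K f" "compact K" "K \<noteq> {}"
  obtains y where "y \<in> K" "\<And>x. x \<in> K \<Longrightarrow> f x \<le> f y"
proof (rule ccontr)
  assume "\<not> thesis"
  then have "\<And>y. y \<in> K \<Longrightarrow> \<exists>x\<in>K. f y < f x"
    using that by (meson not_le)
  then have "K \<subseteq> \<Union>((\<lambda>x. {y \<in> K. f y < f x}) ` K)"
    by auto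
  moreover have "\<forall>c \<in> (\<lambda>x. {y \<in> K. f y < f x}) ` K. openin (top_of_set K) c"
    using assms(1) by (auto simp: usc_on_def)
  ultimately obtain D where D: "D \<subseteq> (\<lambda>x. {y \<in> K. f y < f x}) ` K" "finite D" "K \<subseteq> \<Union>D"
    using assms(2) unfolding compact_eq_openin_cover by meson
  then obtain C where C: "C \<subseteq> K" "finite C" "D = (\<lambda>x. {y \<in> K. f y < f x}) ` C"
    by (meson finite_subset_image)
  then have "C \<noteq> {}"
    using D assms(3) by auto
  then have "Max (f ` C) \<in> f ` C"
    using C(2) by (intro Max_in) auto
  then obtain m where m: "m \<in> C" "f m = Max (f ` C)"
    by auto
  then have "m \<in> \<Union>D"
    using C(1) D(3) by blast
  then obtain x where "x \<in> C" "f m < f x"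
    using C(3) by auto
  then show False
    using m C(2) by (metis Max_ge finite_imageI imageI not_le)
qed

lemma usc_on_subset:
  assumes "usc_on X u" "Y \<subseteq> X"
  shows "usc_on Y u"
  unfolding usc_on_def
proof (intro conjI allI)
  fix c
  obtain T where "open T" and T: "{x \<in> X. u x < c} = X \<inter> T"
    using assms(1) unfolding usc_on_def openin_open by metis
  moreover have "{x \<in> Y. u x < c} = Y \<inter> T"
    using T assms(2) by auto
  ultimately show "openin (top_of_set Y) {x \<in> Y. u x < c}"
    unfolding openin_open by metis
qed (use assms in \<open>auto simp: usc_on_def\<close>)

text \<open>A strict sublevel set of the difference is a union, over a real \<open>r\<close> separating \<open>u x\<close> from
  \<open>c + \<phi> x\<close>, of sublevel sets of \<open>u\<close> intersected with superlevel sets of \<open>\<phi>\<close>.\<close>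

lemma usc_on_diff_continuous:
  fixes u :: "'a::topological_space \<Rightarrow> ereal"
  assumes u: "usc_on X u" and \<phi>: "continuous_on X \<phi>"
  shows "usc_on X (\<lambda>x. u x - ereal (\<phi> x))"
  unfolding usc_on_def
proof (intro conjI allI)
  fix c :: ereal
  have iff: "u x - ereal (\<phi> x) < c \<longleftrightarrow> (\<exists>r. u x < ereal r \<and> ereal r < c + ereal (\<phi> x))" for x
  proof -
    have "u x - ereal (\<phi> x) < c \<longleftrightarrow> u x < c + ereal (\<phi> x)"
      by (simp add: ereal_minus_less)
    then show ?thesis
      using ereal_dense2 order.strict_trans by metis
  qed
  have "{x \<in> X. u x - ereal (\<phi> x) < c}
      = (\<Union>r. {x \<in> X. u x < ereal r} \<inter> {x \<in> X. ereal r < c + ereal (\<phi> x)})"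
    using iff by auto
  moreover have "openin (top_of_set X) {x \<in> X. ereal r < c + ereal (\<phi> x)}" for r
  proof (cases c)
    case (real c')
    have "openin (top_of_set X) (X \<inter> \<phi> -` {r - c'<..})"
      by (rule continuous_openin_preimage_gen[OF \<phi>]) simp
    moreover have "X \<inter> \<phi> -` {r - c'<..} = {x \<in> X. ereal r < c + ereal (\<phi> x)}"
      using real by auto
    ultimately show ?thesis by simp
  qed auto
  ultimately show "openin (top_of_set X) {x \<in> X. u x - ereal (\<phi> x) < c}"
    using u by (auto simp: usc_on_def intro!: openin_Union)
qed (use u in \<open>auto simp: usc_on_def ereal_minus_eq_PInfty_iff\<close>)

lemma usc_on_compose_norm:
  fixes \<psi> :: "real \<Rightarrow> ereal"
  assumes "usc_on J \<psi>"
  shows "usc_on {x::'a::real_normed_vector. norm x \<in> J} (\<lambda>x. \<psi> (norm x))"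
  unfolding usc_on_def
proof (intro conjI allI)
  fix c
  let ?X = "{x::'a. norm x \<in> J}"
  have "openin (top_of_set ?X) (?X \<inter> norm -` {t \<in> J. \<psi> t < c})"
    by (rule continuous_openin_preimage[where T = J])
       (use assms in \<open>auto simp: usc_on_def intro!: continuous_intros\<close>)
  moreover have "?X \<inter> norm -` {t \<in> J. \<psi> t < c} = {x \<in> ?X. \<psi> (norm x) < c}"
    by auto
  ultimately show "openin (top_of_set ?X) {x \<in> ?X. \<psi> (norm x) < c}"
    by simp
qed (use assms in \<open>auto simp: usc_on_def\<close>)

text \<open>Suppose \<open>\<psi> s > \<psi> t\<close> with \<open>s < t\<close>. A decreasing function \<open>\<phi>\<close> that drops by less than
  \<open>\<psi> s - \<psi> t\<close> on \<open>[s, t]\<close> keeps a maximum of \<open>\<psi> - \<phi>\<close> away from \<open>t\<close>. To keep it away from the left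
  end as well, the interval is enlarged to \<open>[s', t]\<close> with \<open>s' < s\<close>, and \<open>\<phi>\<close> has to be so large at \<open>s'\<close>
  that it outweighs the bound for \<open>\<psi>\<close>. An exponential with a large rate does both. At the interior
  maximum a translate of \<open>\<phi>\<close> touches \<open>\<psi>\<close> from above with negative slope.\<close>

lemma mono_on_if_no_decreasing_test:
  fixes \<psi> :: "real \<Rightarrow> ereal"
  assumes J: "open J" "convex J" and usc: "usc_on J \<psi>"
    and test: "\<And>t0 \<phi>. \<lbrakk>t0 \<in> J; C2_near_real \<phi> t0; touches_above \<phi> \<psi> t0\<rbrakk> \<Longrightarrow> 0 \<le> deriv \<phi> t0"
  shows "mono_on J \<psi>"
proof (rule mono_onI, rule ccontr)
  fix s t assume st: "s \<in> J" "t \<in> J" "s \<le> t" and "\<not> \<psi> s \<le> \<psi> t"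
  then have less: "\<psi> t < \<psi> s" by simp
  then have "\<psi> s \<noteq> -\<infinity>" "\<psi> s \<noteq> \<infinity>"
    using usc st by (auto simp: usc_on_def)
  then obtain p where p: "\<psi> s = ereal p"
    by (cases "\<psi> s") auto
  obtain q where q: "\<psi> t < ereal q" "q < p"
    using ereal_dense2[OF less] p by auto
  have "s < t"
    using st(3) less by (cases "s = t") auto
  obtain s' where s': "s' < s" "{s'..t} \<subseteq> J"
  proof -
    obtain r where r: "r > 0" "cball s r \<subseteq> J"
      using J(1) st(1) open_contains_cball by blast
    then have "s - r \<in> J"
      by (auto simp: dist_real_def subset_iff)
    then have "closed_segment (s - r) t \<subseteq> J"
      using J(2) st(2) by (meson convex_contains_segment)
    then show thesis
      using that[of "s - r"] r(1) \<open>s < t\<close> by (simp add: closed_segment_eq_real_ivl)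
  qed
  have usc': "usc_on {s'..t} \<psi>"
    using usc_on_subset[OF usc s'(2)] .
  obtain y0 where y0: "y0 \<in> {s'..t}" "\<And>x. x \<in> {s'..t} \<Longrightarrow> \<psi> x \<le> \<psi> y0"
    using usc_attains_sup[OF usc'] s' \<open>s < t\<close> by auto
  obtain B where B: "\<psi> y0 = ereal B"
    using y0(2)[of s] p usc' y0(1) s'(1) \<open>s < t\<close> by (cases "\<psi> y0") (auto simp: usc_on_def)
  have bound: "\<psi> x \<le> ereal B" if "x \<in> {s'..t}" for x
    using y0(2)[OF that] B by simp
  have pB: "p \<le> B"
    using bound[of s] p s'(1) \<open>s < t\<close> by simp
  \<comment> \<open>\<open>C\<close> bounds the drop of \<open>\<phi>\<close> on \<open>[s, t]\<close>; by \<open>exp y \<ge> 1 + y\<close> the rate \<open>k\<close> makes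
      \<open>\<phi> s' - \<phi> s\<close> at least \<open>B - p + C\<close>, where \<open>B\<close> is the maximum of \<open>\<psi>\<close>.\<close>
  define C where "C = p - q"
  define k where "k = (B - p + C) / (C * (s - s'))"
  define \<phi> where "\<phi> x = C * exp (- (k * (x - s)))" for x
  have C: "C > 0"
    using q by (simp add: C_def)
  have k: "k > 0"
    using C pB s'(1) by (simp add: k_def)
  have kC: "C * (k * (s - s')) = B - p + C"
    using C s'(1) by (simp add: k_def)
  have \<phi>_s': "\<phi> s' > B - p + C"
  proof -
    have "1 + k * (s - s') \<le> exp (k * (s - s'))"
      by (rule exp_ge_add_one_self)
    then have "C * (1 + k * (s - s')) \<le> C * exp (k * (s - s'))"
      using C by (simp add: mult_left_mono)
    then have "C + (B - p + C) \<le> C * exp (k * (s - s'))"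
      using kC by (simp add: distrib_left)
    moreover have "- (k * (s' - s)) = k * (s - s')"
      by (simp add: algebra_simps)
    ultimately have "C + (B - p + C) \<le> \<phi> s'"
      by (simp only: \<phi>_def)
    then show ?thesis
      using C by linarith
  qed
  have "usc_on {s'..t} (\<lambda>x. \<psi> x - ereal (\<phi> x))"
    by (rule usc_on_diff_continuous[OF usc']) (auto simp: \<phi>_def intro!: continuous_intros)
  then obtain m where m: "m \<in> {s'..t}"
    and max: "\<And>x. x \<in> {s'..t} \<Longrightarrow> \<psi> x - ereal (\<phi> x) \<le> \<psi> m - ereal (\<phi> m)"
    using usc_attains_sup[of "{s'..t}" "\<lambda>x. \<psi> x - ereal (\<phi> x)"] s' \<open>s < t\<close> by auto
  \<comment> \<open>The comparison with \<open>s\<close>, where \<open>\<phi> s = C\<close>, also shows that \<open>\<psi> m\<close> is finite.\<close>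
  have "ereal (p - C) \<le> \<psi> m - ereal (\<phi> m)"
    using max[of s] p s'(1) \<open>s < t\<close> by (simp add: \<phi>_def)
  then obtain z where z: "\<psi> m = ereal z" "p - C \<le> z - \<phi> m"
    using usc' m by (cases "\<psi> m") (auto simp: usc_on_def)
  have "m \<noteq> s'"
    using z \<phi>_s' bound[OF m] by auto
  moreover have "m \<noteq> t"
  proof
    assume "m = t"
    then have "z < q" using z q by simp
    moreover have "\<phi> m > 0" using C by (simp add: \<phi>_def)
    ultimately show False
      using z(2) by (simp add: C_def)
  qed
  ultimately have m': "m \<in> {s'<..<t}"
    using m by auto
  define \<eta> where "\<eta> x = \<phi> x + (z - \<phi> m)" for x
  have \<eta>: "C2_near_real \<eta> m" "deriv \<eta> m = - k * \<phi> m"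
    by (rule C2_near_realI[of UNIV m \<eta> "\<lambda>x. - k * \<phi> x" "\<lambda>x. k\<^sup>2 * \<phi> x"];
        auto simp: \<eta>_def[abs_def] \<phi>_def[abs_def] power2_eq_square
          intro!: derivative_eq_intros continuous_intros)+
  moreover have "touches_above \<eta> \<psi> m"
    unfolding touches_above_def
  proof
    have "\<forall>\<^sub>F x in nhds m. x \<in> {s'<..<t}"
      using m' by (intro eventually_nhds_in_open) auto
    then show "\<forall>\<^sub>F x in nhds m. \<psi> x \<le> ereal (\<eta> x)"
    proof eventually_elim
      case (elim x)
      then have "\<psi> x - ereal (\<phi> x) \<le> ereal (z - \<phi> m)"
        using max[of x] z by simp
      then show ?case
        unfolding \<eta>_def by (cases "\<psi> x") auto
    qed
  qed (simp add: \<eta>_def z)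
  ultimately have "0 \<le> deriv \<eta> m"
    using test m s'(2) by blast
  moreover have "k * \<phi> m > 0"
    using k C by (simp add: \<phi>_def)
  ultimately show False
    using \<eta>(2) by simp
qed

text \<open>To the right of \<open>t0\<close> the function \<open>\<phi>\<close> stays above \<open>\<psi> \<ge> \<psi> t0 = \<phi> t0\<close>.\<close>

lemma deriv_nonneg_of_touching_mono_on:
  fixes \<psi> :: "real \<Rightarrow> ereal"
  assumes J: "open J" "t0 \<in> J" and mono: "mono_on J \<psi>"
    and \<phi>: "C2_near_real \<phi> t0" and touch: "touches_above \<phi> \<psi> t0"
  shows "0 \<le> deriv \<phi> t0"
proof (rule ccontr)
  assume neg: "\<not> 0 \<le> deriv \<phi> t0"
  have "(\<phi> has_real_derivative deriv \<phi> t0) (at t0)"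
    using \<phi> by (rule C2_near_realE) blast
  then obtain d where d: "d > 0" "\<And>h. 0 < h \<Longrightarrow> h < d \<Longrightarrow> \<phi> (t0 + h) < \<phi> t0"
    using DERIV_neg_dec_right neg by (meson not_le)
  have "\<forall>\<^sub>F t in nhds t0. t \<in> J \<and> \<psi> t \<le> ereal (\<phi> t)"
    using touch eventually_nhds_in_open[OF J] unfolding touches_above_def
    by (auto elim: eventually_elim2)
  then obtain d' where d': "d' > 0" "\<And>t. dist t t0 < d' \<Longrightarrow> t \<in> J \<and> \<psi> t \<le> ereal (\<phi> t)"
    unfolding eventually_nhds_metric by blast
  define h where "h = min d d' / 2"
  have h: "0 < h" "h < d" "h < d'"
    unfolding h_def using d d' by auto
  have "t0 + h \<in> J" "\<psi> (t0 + h) \<le> ereal (\<phi> (t0 + h))"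
    using d'(2)[of "t0 + h"] h by (simp_all add: dist_real_def)
  moreover have "ereal (\<phi> t0) \<le> \<psi> (t0 + h)"
    using mono_onD[OF mono J(2) \<open>t0 + h \<in> J\<close>] h touch by (simp add: touches_above_def)
  ultimately have "ereal (\<phi> t0) \<le> ereal (\<phi> (t0 + h))"
    by (meson order_trans)
  then show False
    using d(2)[OF h(1,2)] by simp
qed

section \<open>Test functions for a radial function\<close>

text \<open>On the sphere of radius \<open>\<rho>\<close> the radial function is constant, so \<open>\<phi>\<close> restricted to it has a local
  minimum at \<open>\<rho> e\<close>. The first and second derivative tests along great circles give the two claims;
  the curvature of the circle contributes the term with the radial derivative.\<close>

lemma inner_gradient_eq_0_and_hessian_ge_on_tangent_space:
  fixes \<phi> :: "real^'n \<Rightarrow> real" and \<psi> :: "real \<Rightarrow> ereal"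
  assumes \<phi>: "C2_near \<phi> (\<rho> *\<^sub>R e)" and touch: "touches_above \<phi> (\<lambda>x. \<psi> (norm x)) (\<rho> *\<^sub>R e)"
    and \<rho>: "\<rho> > 0" and e: "norm e = 1" and v: "v \<bullet> e = 0"
  shows "gradient \<phi> (\<rho> *\<^sub>R e) \<bullet> v = 0"
    and "(gradient \<phi> (\<rho> *\<^sub>R e) \<bullet> e / \<rho>) * (v \<bullet> v) \<le> v \<bullet> (hessian \<phi> (\<rho> *\<^sub>R e) *v v)"
proof -
  let ?G = "gradient \<phi> (\<rho> *\<^sub>R e)" and ?H = "hessian \<phi> (\<rho> *\<^sub>R e)"
  have "?G \<bullet> v = 0 \<and> (?G \<bullet> e / \<rho>) * (v \<bullet> v) \<le> v \<bullet> (?H *v v)"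
  proof (cases "v = 0")
    case False
    define w where "w = sgn v"
    have w: "norm w = 1" "w \<bullet> e = 0" and vw: "v = norm v *\<^sub>R w"
      using False v by (simp_all add: w_def norm_sgn sgn_div_norm)
    define g where "g t = \<phi> (polar_curve e w 1 \<rho> 0 \<rho> t)" for t
    have C2: "C2_near_real g \<rho>" and g': "deriv g \<rho> = ?G \<bullet> (\<rho> *\<^sub>R w)"
      and g'': "deriv (deriv g) \<rho> = (\<rho> *\<^sub>R w) \<bullet> (?H *v (\<rho> *\<^sub>R w)) - \<rho> * (?G \<bullet> e)"
      using C2_near_real_along_polar_curve[of \<phi> \<rho> 0 \<rho> e w 1] \<phi> by (simp_all add: g_def[abs_def])
    have "(polar_curve e w 1 \<rho> 0 \<rho> \<longlongrightarrow> \<rho> *\<^sub>R e) (nhds \<rho>)"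
      using tendsto_polar_curve[of e w 1 \<rho> 0 \<rho>] by simp
    then have "\<forall>\<^sub>F t in nhds \<rho>. \<psi> (norm (polar_curve e w 1 \<rho> 0 \<rho> t)) \<le> ereal (g t)"
      using touch unfolding touches_above_def g_def
      by (auto intro: eventually_compose_filterlim)
    moreover have "norm (polar_curve e w 1 \<rho> 0 \<rho> t) = \<rho>" for t
      using norm_polar_curve[OF e w(2)] w(1) \<rho> by simp
    moreover have "\<psi> \<rho> = ereal (g \<rho>)"
      using touch \<rho> e by (simp add: touches_above_def g_def polar_curve_def)
    ultimately have "\<forall>\<^sub>F t in nhds \<rho>. g \<rho> \<le> g t"
      by simp
    from second_derivative_nonneg_at_local_min[OF C2 this]
    have Gw: "?G \<bullet> w = 0" and "0 \<le> \<rho> * (\<rho> * (w \<bullet> (?H *v w)) - ?G \<bullet> e)"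
      using g' g'' \<rho> by (simp_all add: matrix_vector_mult_scaleR algebra_simps)
    then have "?G \<bullet> e \<le> \<rho> * (w \<bullet> (?H *v w))"
      using \<rho> by (simp add: zero_le_mult_iff)
    then have "?G \<bullet> e / \<rho> \<le> w \<bullet> (?H *v w)"
      using \<rho> by (simp add: field_simps)
    then have "(?G \<bullet> e / \<rho>) * (norm v)\<^sup>2 \<le> (w \<bullet> (?H *v w)) * (norm v)\<^sup>2"
      by (intro mult_right_mono) auto
    moreover have "v \<bullet> (?H *v v) = (w \<bullet> (?H *v w)) * (norm v)\<^sup>2"
      by (subst (1 2) vw) (simp add: matrix_vector_mult_scaleR power2_eq_square)
    moreover have "?G \<bullet> v = 0"
      by (subst vw) (simp add: Gw)
    ultimately show ?thesis
      by (simp add: power2_norm_eq_inner)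
  qed simp
  then show "?G \<bullet> v = 0" "(?G \<bullet> e / \<rho>) * (v \<bullet> v) \<le> v \<bullet> (?H *v v)"
    by blast+
qed

text \<open>The test function is \<open>\<phi>\<close> along a spiral \<open>\<gamma>\<close> with \<open>|\<gamma>(t)| = t\<close> and velocity \<open>e + v\<close> at \<open>t = \<rho>\<close>. In its
  second derivative the acceleration of \<open>\<gamma>\<close> counts only through its radial part \<open>- (|v|\<^sup>2/\<rho>) e\<close>,
  since the gradient of \<open>\<phi>\<close> is radial.\<close>

lemma touches_above_along_polar_curve:
  fixes \<phi> :: "real^'n \<Rightarrow> real" and \<psi> :: "real \<Rightarrow> ereal"
  assumes \<phi>: "C2_near \<phi> (\<rho> *\<^sub>R e)" and touch: "touches_above \<phi> (\<lambda>x. \<psi> (norm x)) (\<rho> *\<^sub>R e)"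
    and \<rho>: "\<rho> > 0" and e: "norm e = 1" and v: "v \<bullet> e = 0"
  obtains g where "C2_near_real g \<rho>" "touches_above g \<psi> \<rho>"
    "deriv g \<rho> = gradient \<phi> (\<rho> *\<^sub>R e) \<bullet> e"
    "deriv (deriv g) \<rho> = (e + v) \<bullet> (hessian \<phi> (\<rho> *\<^sub>R e) *v (e + v))
       - (gradient \<phi> (\<rho> *\<^sub>R e) \<bullet> e / \<rho>) * (v \<bullet> v)"
proof -
  let ?G = "gradient \<phi> (\<rho> *\<^sub>R e)" and ?H = "hessian \<phi> (\<rho> *\<^sub>R e)"
  \<comment> \<open>For \<open>v = 0\<close> this gives \<open>w = 0\<close> and \<open>k = 0\<close>, that is, the ray through \<open>e\<close>.\<close>
  define w k where "w = sgn v" and "k = norm v / \<rho>"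
  have w: "norm w = 1 \<or> k = 0"
    by (cases "v = 0") (auto simp: w_def k_def norm_sgn)
  have we: "w \<bullet> e = 0"
    using v by (simp add: w_def sgn_div_norm)
  have vw: "(\<rho> * k) *\<^sub>R w = v"
    using \<rho> by (cases "v = 0") (auto simp: w_def k_def sgn_div_norm)
  have Gv: "?G \<bullet> v = 0"
    using inner_gradient_eq_0_and_hessian_ge_on_tangent_space(1)[OF assms] .
  then have Gw: "?G \<bullet> w = 0"
    by (simp add: w_def sgn_div_norm)
  define g where "g t = \<phi> (polar_curve e w k 0 1 \<rho> t)" for t
  have *: "C2_near_real g \<rho>" "deriv g \<rho> = ?G \<bullet> (e + v)"
    "deriv (deriv g) \<rho> = (e + v) \<bullet> (?H *v (e + v)) + ?G \<bullet> ((2 * k) *\<^sub>R w - (\<rho> * k\<^sup>2) *\<^sub>R e)"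
    using C2_near_real_along_polar_curve[of \<phi> 0 1 \<rho> e w k] \<phi> by (simp_all add: g_def[abs_def] vw)
  have kk: "\<rho> * k\<^sup>2 = (v \<bullet> v) / \<rho>"
    using \<rho> by (simp add: k_def power2_norm_eq_inner power_divide power2_eq_square[of \<rho>])
  have "?G \<bullet> ((2 * k) *\<^sub>R w - (\<rho> * k\<^sup>2) *\<^sub>R e) = - (?G \<bullet> e / \<rho>) * (v \<bullet> v)"
    unfolding kk by (simp add: inner_diff_right Gw)
  then have g'': "deriv (deriv g) \<rho> = (e + v) \<bullet> (?H *v (e + v)) - (?G \<bullet> e / \<rho>) * (v \<bullet> v)"
    using *(3) by simp
  have g': "deriv g \<rho> = ?G \<bullet> e"
    using *(2) Gv by (simp add: inner_add_right)
  have "(polar_curve e w k 0 1 \<rho> \<longlongrightarrow> \<rho> *\<^sub>R e) (nhds \<rho>)"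
    using tendsto_polar_curve[of e w k 0 1 \<rho>] by simp
  then have "\<forall>\<^sub>F t in nhds \<rho>. \<psi> (norm (polar_curve e w k 0 1 \<rho> t)) \<le> ereal (g t)"
    using touch unfolding touches_above_def g_def
    by (auto intro: eventually_compose_filterlim)
  moreover have "\<forall>\<^sub>F t in nhds \<rho>. t \<in> {0<..}"
    using \<rho> by (intro eventually_nhds_in_open) auto
  ultimately have "\<forall>\<^sub>F t in nhds \<rho>. \<psi> t \<le> ereal (g t)"
    by eventually_elim (use norm_polar_curve[OF e we w, of 0 1 \<rho>] in simp)
  moreover have "\<psi> \<rho> = ereal (g \<rho>)"
    using touch \<rho> e by (simp add: touches_above_def g_def polar_curve_def)
  ultimately have "touches_above g \<psi> \<rho>"
    by (simp add: touches_above_def)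
  then show thesis
    using that *(1) g' g'' by blast
qed

lemma subequation_closure:
  fixes H :: "real^'n^'n"
  assumes "subequation F" "transpose H = H" "\<And>\<epsilon>. \<epsilon> > 0 \<Longrightarrow> H + \<epsilon> *\<^sub>R mat 1 \<in> F"
  shows "H \<in> F"
proof -
  obtain T where T: "closed T" "F = sym_matrices \<inter> T"
    using assms(1) unfolding subequation_def closedin_closed by blast
  have "(\<lambda>n. H + inverse (real (Suc n)) *\<^sub>R mat 1) \<longlonglongrightarrow> H + 0 *\<^sub>R mat 1"
    by (intro tendsto_intros LIMSEQ_inverse_real_of_nat)
  then have "H \<in> T"
    using T assms(3) closed_sequentially[of T "\<lambda>n. H + inverse (real (Suc n)) *\<^sub>R mat 1" H] by simp
  then show ?thesis
    using T assms(2) by (simp add: sym_matrices_def)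
qed

text \<open>The vector \<open>v\<close> that completes the square selects the spiral along which \<open>\<phi>\<close> is tested; the matrix
  obtained in \<open>F\<close> then lies below \<open>H + \<epsilon> I\<close>.\<close>

lemma hessian_mem_if_radial_subharmonic:
  fixes \<phi> :: "real^'n \<Rightarrow> real"
  assumes F: "subequation F" and J: "J \<subseteq> {0<..}"
    and sub: "subharmonic_on_real (incr_radial_subeq F) J \<psi>"
    and x0: "norm x0 \<in> J" and \<phi>: "C2_near \<phi> x0" and touch: "touches_above \<phi> (\<lambda>x. \<psi> (norm x)) x0"
  shows "hessian \<phi> x0 \<in> F"
proof (rule subequation_closure[OF F hessian_symmetric[OF \<phi>]])
  fix \<epsilon> :: real assume \<epsilon>: "\<epsilon> > 0"
  define \<rho> e where "\<rho> = norm x0" and "e = sgn x0"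
  have \<rho>: "\<rho> > 0" and \<rho>J: "\<rho> \<in> J"
    using J x0 by (auto simp: \<rho>_def)
  then have e: "norm e = 1" and x0_eq: "x0 = \<rho> *\<^sub>R e"
    by (auto simp: \<rho>_def e_def norm_sgn sgn_div_norm)
  define \<mu> where "\<mu> = gradient \<phi> x0 \<bullet> e / \<rho>"
  note hyps = \<phi>[unfolded x0_eq] touch[unfolded x0_eq] \<rho> e
  have "\<mu> * (v \<bullet> v) \<le> v \<bullet> (hessian \<phi> x0 *v v)" if "v \<bullet> e = 0" for v
    using inner_gradient_eq_0_and_hessian_ge_on_tangent_space(2)[OF hyps that]
    unfolding \<mu>_def x0_eq .
  then obtain v where v: "v \<bullet> e = 0"
    and psd: "hessian \<phi> x0 + \<epsilon> *\<^sub>R mat 1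
      - (\<mu> *\<^sub>R proj_perp e
        + ((e + v) \<bullet> (hessian \<phi> x0 *v (e + v)) - \<mu> * (v \<bullet> v)) *\<^sub>R proj_line e) \<in> psd_matrices"
      (is "_ - ?A \<in> _")
    using radial_matrix_below_perturbation[OF hessian_symmetric[OF \<phi>] e \<epsilon>] by metis
  obtain g where "C2_near_real g \<rho>" "touches_above g \<psi> \<rho>"
    "deriv g \<rho> = gradient \<phi> x0 \<bullet> e"
    "deriv (deriv g) \<rho> = (e + v) \<bullet> (hessian \<phi> x0 *v (e + v)) - \<mu> * (v \<bullet> v)"
    using touches_above_along_polar_curve[OF hyps v] unfolding \<mu>_def x0_eq by metis
  then have "(gradient \<phi> x0 \<bullet> e, (e + v) \<bullet> (hessian \<phi> x0 *v (e + v)) - \<mu> * (v \<bullet> v))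
      \<in> incr_radial_subeq F \<rho>"
    using sub \<rho>J unfolding subharmonic_on_real_def by metis
  then have "?A \<in> F"
    using e by (simp add: incr_radial_subeq_def \<mu>_def)
  then have "?A + (hessian \<phi> x0 + \<epsilon> *\<^sub>R mat 1 - ?A) \<in> F"
    using F psd unfolding subequation_def by blast
  then show "hessian \<phi> x0 + \<epsilon> *\<^sub>R mat 1 \<in> F"
    by simp
qed

section \<open>Increasing radial subharmonic functions\<close>

theorem theorem2p7:
  fixes F :: "(real^'n^'n) set" and \<psi> :: "real \<Rightarrow> ereal" and a b :: ereal
  assumes "subequation F"
    and "einterval a b \<subseteq> {0<..}"
    and "usc_on (einterval a b) \<psi>"
  shows "subharmonic_on F {x. a < ereal (norm x) \<and> ereal (norm x) < b} (\<lambda>x. \<psi> (norm x)) \<and>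
           mono_on (einterval a b) \<psi>
         \<longleftrightarrow> subharmonic_on_real (incr_radial_subeq F) (einterval a b) \<psi>"
proof -
  define J where "J = einterval a b"
  have "t \<in> J" if "r \<in> J" "s \<in> J" "r \<le> t" "t \<le> s" for r s t
    using that le_less_trans[of "ereal t" "ereal s" b] less_le_trans[of a "ereal r" "ereal t"]
    by (simp add: J_def einterval_iff)
  then have "is_interval J"
    unfolding is_interval_1 by blast
  then have J: "open J" "convex J" "J \<subseteq> {0<..}"
    using assms(2) by (simp_all add: J_def is_interval_convex_1)
  have usc: "usc_on J \<psi>"
    using assms(3) by (simp add: J_def)
  have X: "{x::real^'n. a < ereal (norm x) \<and> ereal (norm x) < b} = {x. norm x \<in> J}"
    by (simp add: J_def einterval_iff)
  have "subharmonic_on_real (incr_radial_subeq F) J \<psi>"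
    if sub: "subharmonic_on F {x. norm x \<in> J} (\<lambda>x. \<psi> (norm x))" and mono: "mono_on J \<psi>"
    unfolding subharmonic_on_real_def
  proof (intro conjI ballI allI impI)
    fix t0 \<phi> assume t0: "t0 \<in> J" and "C2_near_real \<phi> t0 \<and> touches_above \<phi> \<psi> t0"
    then have \<phi>: "C2_near_real \<phi> t0" and touch: "touches_above \<phi> \<psi> t0"
      by auto
    have pos: "t0 > 0"
      using J t0 by auto
    have "(deriv \<phi> t0 / t0) *\<^sub>R proj_perp e + deriv (deriv \<phi>) t0 *\<^sub>R proj_line e \<in> F"
      if e: "norm e = 1" for e :: "real^'n"
    proof -
      define x0 where "x0 = t0 *\<^sub>R e"
      have x0: "norm x0 = t0" "x0 \<noteq> 0" "sgn x0 = e"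
        using pos e by (auto simp: x0_def sgn_div_norm)
      have "hessian (\<lambda>x. \<phi> (norm x)) x0 \<in> F"
        using sub t0 x0 C2_near_radial(1)[of \<phi> x0] touches_above_compose_norm[of \<phi> \<psi> x0] \<phi> touch
        unfolding subharmonic_on_def by auto
      then show ?thesis
        using C2_near_radial(2)[of \<phi> x0] \<phi> x0 by simp
    qed
    then show "(deriv \<phi> t0, deriv (deriv \<phi>) t0) \<in> incr_radial_subeq F t0"
      using deriv_nonneg_of_touching_mono_on[OF J(1) t0 mono \<phi> touch]
      by (simp add: incr_radial_subeq_def)
  qed (use J usc in auto)
  moreover have "subharmonic_on F {x. norm x \<in> J} (\<lambda>x. \<psi> (norm x)) \<and> mono_on J \<psi>"
    if sub: "subharmonic_on_real (incr_radial_subeq F) J \<psi>"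
  proof
    have "open {x::real^'n. norm x \<in> J}"
      using open_vimage[OF J(1), of "norm :: real^'n \<Rightarrow> real"] by (simp add: vimage_def continuous_intros)
    then show "subharmonic_on F {x. norm x \<in> J} (\<lambda>x. \<psi> (norm x))"
      unfolding subharmonic_on_def
      using usc_on_compose_norm[OF usc] hessian_mem_if_radial_subharmonic[OF assms(1) J(3) sub]
      by auto
    show "mono_on J \<psi>"
    proof (rule mono_on_if_no_decreasing_test[OF J(1,2) usc])
      fix t0 \<phi> assume "t0 \<in> J" "C2_near_real \<phi> t0" "touches_above \<phi> \<psi> t0"
      then have "(deriv \<phi> t0, deriv (deriv \<phi>) t0) \<in> incr_radial_subeq F t0"
        using sub by (simp add: subharmonic_on_real_def)
      then show "0 \<le> deriv \<phi> t0"
        by (simp add: incr_radial_subeq_def)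
    qed
  qed
  ultimately show ?thesis
    unfolding X J_def[symmetric] by blast
qed

end
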